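(* Let $G$ be an abstract group. (1) The following are equivalent: (a) $G$ is orderable; (b) $G$ is dynamically orderable as a discrete group, i.e., $G$ admits an ordered semigroup compactification $\gamma\colon G\to S$ which is a topological embedding of the discrete group $G$. (2) If $G$ is countable (and satisfies the equivalent conditions in (1)), then one may choose $S$ in (b) such that, in addition, $S$ is first countable and hereditarily separable.
   Context: A group $G$ is orderable if it admits a bi-invariant linear order, i.e. a linear order $\leq$ with $x\leq y\Leftrightarrow gx\leq gy\Leftrightarrow xg\leq yg$ for all $g,x,y\in G$. The interval topology of a linearly ordered set has as subbase all rays $\{x: a<x\}$, $\{x: x<b\}$. A compact right topological semigroup is a semigroup $S$ with a compact Hausdorff topology for which each right translation $x\mapsto xs$ is continuous. It is a linearly ordered compact right topological semigroup if there is a linear order on $S$ which is bi-invariant ($x\le y$ implies $sx\le sy$ and $xs\le ys$ for all $s$) and whose interval topology is the given topology. A right topological semigroup compactification of a topological group $G$ is a continuous homomorphism $\gamma\colon G\to S$ into a compact right topological semigroup with dense image such that the action $G\times S\to S$, $(g,s)\mapsto\gamma(g)s$, is continuous. An ordered semigroup compactification of $G$ is a right topological semigroup compactification $\gamma\colon G\to S$, where $G$ is endowed with a bi-invariant linear order, $S$ is a linearly ordered compact right topological semigroup, and $\gamma$ is order preserving ($x\le y\Rightarrow\gamma(x)\le\gamma(y)$). (The topology of $G$ need not be the interval topology of its order; in (b) it is discrete.) A topological space is hereditarily separable if each of its subspaces is separable. *)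

theory Defs
  imports "HOL-Analysis.Analysis" "HOL-Algebra.Group"
begin

text \<open>
  Linear orders are relations \<open>r\<close> with \<open>linear_order_on A r\<close>, where \<open>(x, y) \<in> r\<close> means
  \<open>x \<le> y\<close>; this includes \<open>r \<subseteq> A \<times> A\<close>.
\<close>

definition bi_invariant_linear_order :: "('a, 'm) monoid_scheme \<Rightarrow> 'a rel \<Rightarrow> bool" where
  "bi_invariant_linear_order G r \<longleftrightarrow>
     linear_order_on (carrier G) r \<and>
     (\<forall>g\<in>carrier G. \<forall>x\<in>carrier G. \<forall>y\<in>carrier G.
        ((x, y) \<in> r \<longleftrightarrow> (g \<otimes>\<^bsub>G\<^esub> x, g \<otimes>\<^bsub>G\<^esub> y) \<in> r) \<and>
        ((x, y) \<in> r \<longleftrightarrow> (x \<otimes>\<^bsub>G\<^esub> g, y \<otimes>\<^bsub>G\<^esub> g) \<in> r))"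

definition orderable_group :: "('a, 'm) monoid_scheme \<Rightarrow> bool" where
  "orderable_group G \<longleftrightarrow> (\<exists>r. bi_invariant_linear_order G r)"

text \<open>
  \<open>topology_generated_by \<S>\<close> has underlying set \<open>\<Union>\<S>\<close>. The set \<open>A\<close> is inserted into the subbase
  of open rays (as the empty intersection) so that a one-point order, which has no nonempty open
  ray, also gets the right underlying set.
\<close>

definition interval_topology :: "'s set \<Rightarrow> 's rel \<Rightarrow> 's topology" where
  "interval_topology A r = topology_generated_by
     (insert A ({{x \<in> A. (a, x) \<in> r \<and> x \<noteq> a} | a. a \<in> A} \<union>
                {{x \<in> A. (x, b) \<in> r \<and> x \<noteq> b} | b. b \<in> A}))"

definition topological_group :: "('a, 'm) monoid_scheme \<Rightarrow> 'a topology \<Rightarrow> bool" where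
  "topological_group G T \<longleftrightarrow>
     group G \<and> topspace T = carrier G \<and>
     continuous_map (prod_topology T T) T (\<lambda>(x, y). x \<otimes>\<^bsub>G\<^esub> y) \<and>
     continuous_map T T (\<lambda>x. inv\<^bsub>G\<^esub> x)"

text \<open>
  A semigroup \<open>S\<close> with a topology is given by a topology \<open>X\<close>, whose underlying set \<open>topspace X\<close> is
  the carrier of \<open>S\<close>, and an operation \<open>m\<close> that matters only on this carrier.
\<close>

definition compact_right_topological_semigroup :: "'s topology \<Rightarrow> ('s \<Rightarrow> 's \<Rightarrow> 's) \<Rightarrow> bool" where
  "compact_right_topological_semigroup X m \<longleftrightarrow>
     (\<forall>x\<in>topspace X. \<forall>y\<in>topspace X. m x y \<in> topspace X) \<and>
     (\<forall>x\<in>topspace X. \<forall>y\<in>topspace X. \<forall>z\<in>topspace X. m (m x y) z = m x (m y z)) \<and>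
     compact_space X \<and> Hausdorff_space X \<and>
     (\<forall>s\<in>topspace X. continuous_map X X (\<lambda>x. m x s))"

definition linearly_ordered_compact_right_topological_semigroup ::
    "'s topology \<Rightarrow> ('s \<Rightarrow> 's \<Rightarrow> 's) \<Rightarrow> 's rel \<Rightarrow> bool" where
  "linearly_ordered_compact_right_topological_semigroup X m r \<longleftrightarrow>
     compact_right_topological_semigroup X m \<and>
     linear_order_on (topspace X) r \<and>
     (\<forall>s\<in>topspace X. \<forall>x\<in>topspace X. \<forall>y\<in>topspace X.
        (x, y) \<in> r \<longrightarrow> (m s x, m s y) \<in> r \<and> (m x s, m y s) \<in> r) \<and>
     X = interval_topology (topspace X) r"

definition right_topological_semigroup_compactification ::
    "('a, 'm) monoid_scheme \<Rightarrow> 'a topology \<Rightarrow> 's topology \<Rightarrow> ('s \<Rightarrow> 's \<Rightarrow> 's) \<Rightarrow> ('a \<Rightarrow> 's) \<Rightarrow> bool" where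
  "right_topological_semigroup_compactification G T X m \<gamma> \<longleftrightarrow>
     topological_group G T \<and>
     compact_right_topological_semigroup X m \<and>
     continuous_map T X \<gamma> \<and>
     (\<forall>g\<in>carrier G. \<forall>h\<in>carrier G. \<gamma> (g \<otimes>\<^bsub>G\<^esub> h) = m (\<gamma> g) (\<gamma> h)) \<and>
     X closure_of (\<gamma> ` carrier G) = topspace X \<and>
     continuous_map (prod_topology T X) X (\<lambda>(g, s). m (\<gamma> g) s)"

text \<open>Here \<open>R\<close> is the order on \<open>G\<close> and \<open>r\<close> the order on the semigroup.\<close>

definition ordered_semigroup_compactification ::
    "('a, 'm) monoid_scheme \<Rightarrow> 'a topology \<Rightarrow> 'a rel \<Rightarrow>
     's topology \<Rightarrow> ('s \<Rightarrow> 's \<Rightarrow> 's) \<Rightarrow> 's rel \<Rightarrow> ('a \<Rightarrow> 's) \<Rightarrow> bool" where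
  "ordered_semigroup_compactification G T R X m r \<gamma> \<longleftrightarrow>
     right_topological_semigroup_compactification G T X m \<gamma> \<and>
     bi_invariant_linear_order G R \<and>
     linearly_ordered_compact_right_topological_semigroup X m r \<and>
     (\<forall>x\<in>carrier G. \<forall>y\<in>carrier G. (x, y) \<in> R \<longrightarrow> (\<gamma> x, \<gamma> y) \<in> r)"

text \<open>
  HOL cannot quantify existentially over the type that carries the semigroup, so that type is a
  parameter. For \<open>G\<close> on the type \<open>'a\<close>, the type \<open>'a set set\<close> is large enough to lose nothing:
  since \<open>\<gamma>\<close> has dense image and the semigroup is Hausdorff, a point \<open>s\<close> of it is determined by the
  set of all \<open>A \<subseteq> carrier G\<close> with \<open>s\<close> in the closure of \<open>\<gamma> ` A\<close>, so every such compactification has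
  an isomorphic copy carried by a subset of \<open>'a set set\<close>.
\<close>

definition dynamically_orderable ::
    "'s itself \<Rightarrow> ('a, 'm) monoid_scheme \<Rightarrow> 'a topology \<Rightarrow> bool" where
  "dynamically_orderable _ G T \<longleftrightarrow>
     (\<exists>R (X :: 's topology) m r \<gamma>.
        ordered_semigroup_compactification G T R X m r \<gamma> \<and> embedding_map T X \<gamma>)"

definition hereditarily_separable :: "'s topology \<Rightarrow> bool" where
  "hereditarily_separable X \<longleftrightarrow> (\<forall>A. A \<subseteq> topspace X \<longrightarrow> separable_space (subtopology X A))"

end

theory Submission
  imports Defs
begin

text \<open>
  Let \<open>D\<close> be the set of initial segments of the ordered group \<open>G\<close>. The compactification consists
  of the initial segments \<open>p\<close> of \<open>(D, \<subseteq>)\<close> with \<open>{} \<in> p\<close> and \<open>G \<notin> p\<close>, ordered by inclusion: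
  besides the elements of \<open>G\<close> it has a point for each one-sided limit in \<open>G\<close>, so that monotone maps
  extend continuously. As a subspace of \<open>2\<^sup>D\<close> it carries the product topology, in which
  sets of the form \<open>{p. K \<in> p \<and> L \<notin> p}\<close> are a base. The product \<open>p q\<close> is the limit of \<open>g q\<close> as
  \<open>g \<in> G\<close> tends to \<open>p\<close>; it turns out that \<open>K \<in> p q\<close> iff the initial segment
  \<open>{g. g\<inverse>K \<notin> q}\<close> belongs to \<open>p\<close>, which makes right continuity and associativity immediate.
\<close>

section \<open>Initial segments of a linear order and cuts of segments\<close>

locale linearly_ordered_set =
  fixes C :: "'a set" and R :: "'a rel"
  assumes linear_order: "linear_order_on C R"
begin

lemma rel_carrier: "(x, y) \<in> R \<Longrightarrow> x \<in> C \<and> y \<in> C"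
  using linear_order
  by (auto simp: linear_order_on_def partial_order_on_def preorder_on_def refl_on_def)

lemma rel_refl: "x \<in> C \<Longrightarrow> (x, x) \<in> R"
  using linear_order
  by (auto simp: linear_order_on_def partial_order_on_def preorder_on_def refl_on_def)

lemma rel_trans: "(x, y) \<in> R \<Longrightarrow> (y, z) \<in> R \<Longrightarrow> (x, z) \<in> R"
  using linear_order
  by (auto simp: linear_order_on_def partial_order_on_def preorder_on_def elim: transE)

lemma rel_antisym: "(x, y) \<in> R \<Longrightarrow> (y, x) \<in> R \<Longrightarrow> x = y"
  using linear_order
  by (auto simp: linear_order_on_def partial_order_on_def antisym_def)

lemma rel_total: "x \<in> C \<Longrightarrow> y \<in> C \<Longrightarrow> (x, y) \<in> R \<or> (y, x) \<in> R"
  using linear_order rel_refl[of x]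
  by (cases "x = y") (auto simp: linear_order_on_def total_on_def)

definition segments :: "'a set set" where
  "segments = {K. K \<subseteq> C \<and> (\<forall>x y. (x, y) \<in> R \<longrightarrow> y \<in> K \<longrightarrow> x \<in> K)}"

text \<open>The two end conditions discard the empty collection and the collection of all segments.
  Either would be an isolated end point outside the closure of the points of
  \<open>C\<close>.\<close>

definition cuts :: "'a set set set" where
  "cuts = {p. p \<subseteq> segments \<and> {} \<in> p \<and> C \<notin> p \<and>
              (\<forall>K\<in>segments. \<forall>L\<in>p. K \<subseteq> L \<longrightarrow> K \<in> p)}"

definition cut_order :: "'a set set rel" where
  "cut_order = {(p, q). p \<in> cuts \<and> q \<in> cuts \<and> p \<subseteq> q}"

text \<open>Starting from the interval topology settles the order-topology clause of a linearly
  ordered semigroup; the product description is derived from it.\<close>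

definition cut_space :: "'a set set topology" where
  "cut_space = interval_topology cuts cut_order"

text \<open>A nonempty set of this form forces \<open>K\<close> to be a segment, so the lemmas below
  constrain only \<open>L\<close>.\<close>

definition between :: "'a set \<Rightarrow> 'a set \<Rightarrow> 'a set set set" where
  "between K L = {p \<in> cuts. K \<in> p \<and> L \<notin> p}"

text \<open>For \<open>g\<close> in \<open>C\<close> this is the cut with greatest element
  \<open>less_segment g\<close>; the least segment outside it is
  \<open>le_segment g\<close>.\<close>

definition point :: "'a \<Rightarrow> 'a set set" where
  "point g = {K \<in> segments. g \<notin> K}"

definition less_segment :: "'a \<Rightarrow> 'a set" where
  "less_segment g = {x. (x, g) \<in> R \<and> x \<noteq> g}"

definition le_segment :: "'a \<Rightarrow> 'a set" where
  "le_segment g = {x. (x, g) \<in> R}"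

text \<open>Countable when \<open>C\<close> is; these are the bounds from which countable local
  bases and dense sets are built.\<close>

definition principal_segments :: "'a set set" where
  "principal_segments = less_segment ` C \<union> le_segment ` C"

lemma empty_segment: "{} \<in> segments" and carrier_segment: "C \<in> segments"
  using rel_carrier by (auto simp: segments_def)

lemma Union_segment: "\<K> \<subseteq> segments \<Longrightarrow> \<Union>\<K> \<in> segments"
  unfolding segments_def by blast

lemma less_segment: "less_segment g \<in> segments"
  unfolding segments_def less_segment_def using rel_carrier rel_trans rel_antisym by blast

lemma le_segment: "le_segment g \<in> segments"
  unfolding segments_def le_segment_def using rel_carrier rel_trans by blast

lemma principal_segments_subset: "principal_segments \<subseteq> segments"
  unfolding principal_segments_def using less_segment le_segment by blast

lemma segments_total: "K \<in> segments \<Longrightarrow> L \<in> segments \<Longrightarrow> K \<subseteq> L \<or> L \<subseteq> K"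
  unfolding segments_def using rel_total by blast

lemma segment_subset_less_segment:
  "K \<in> segments \<Longrightarrow> g \<in> C \<Longrightarrow> g \<notin> K \<Longrightarrow> K \<subseteq> less_segment g"
  unfolding segments_def less_segment_def using rel_total by blast

lemma le_segment_subset: "K \<in> segments \<Longrightarrow> g \<in> K \<Longrightarrow> le_segment g \<subseteq> K"
  unfolding segments_def le_segment_def by blast

lemma less_segment_subset: "K \<in> segments \<Longrightarrow> g \<in> K \<Longrightarrow> less_segment g \<subseteq> K"
  unfolding segments_def less_segment_def by blast

lemma cut_downward: "p \<in> cuts \<Longrightarrow> L \<in> p \<Longrightarrow> K \<in> segments \<Longrightarrow> K \<subseteq> L \<Longrightarrow> K \<in> p"
  by (auto simp: cuts_def)

lemma cut_segments: "p \<in> cuts \<Longrightarrow> K \<in> p \<Longrightarrow> K \<in> segments"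
  by (auto simp: cuts_def)

lemma cut_bounds: "p \<in> cuts \<Longrightarrow> {} \<in> p \<and> C \<notin> p"
  by (auto simp: cuts_def)

text \<open>Segments are comparable and cuts are closed downward, so every member of a cut lies
  strictly inside every segment that is not a member.\<close>

lemma subset_not_in_cut:
  "p \<in> cuts \<Longrightarrow> K \<in> p \<Longrightarrow> L \<in> segments \<Longrightarrow> L \<notin> p \<Longrightarrow> K \<subset> L"
  using segments_total[of K L] cut_downward[of p K L] cut_segments[of p K] by blast

lemma cuts_total:
  assumes "p \<in> cuts" "q \<in> cuts"
  shows "p \<subseteq> q \<or> q \<subseteq> p"
proof (rule disjCI)
  assume "\<not> q \<subseteq> p"
  then obtain L where "L \<in> q" "L \<notin> p" by blast
  then show "p \<subseteq> q"
    using subset_not_in_cut[OF assms(1)] cut_segments assms cut_downward[OF assms(2)] by blast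
qed

lemma linear_order_cuts: "linear_order_on cuts cut_order"
  unfolding linear_order_on_def partial_order_on_def preorder_on_def refl_on_def total_on_def
    antisym_def trans_def cut_order_def using cuts_total by auto

lemma point_cut: "g \<in> C \<Longrightarrow> point g \<in> cuts"
  unfolding cuts_def point_def using empty_segment by auto

lemma point_mono: "(x, y) \<in> R \<Longrightarrow> point x \<subseteq> point y"
  unfolding point_def segments_def by blast

section \<open>The interval topology on cuts and its base\<close>

text \<open>By comparability, the larger of \<open>K\<close>, \<open>K'\<close> and the smaller of
  \<open>L\<close>, \<open>L'\<close> work. This turns the sets \<open>between K L\<close> into a
  base rather than a subbase.\<close>

lemma between_inter:
  assumes "p \<in> between K L" "p \<in> between K' L'"
    and "L \<in> segments" "L' \<in> segments"
  obtains K'' L'' where "L'' \<in> segments" "p \<in> between K'' L''"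
    "between K'' L'' \<subseteq> between K L \<inter> between K' L'"
proof -
  have p: "p \<in> cuts" using assms by (simp add: between_def)
  have K: "K \<in> segments" "K' \<in> segments" using assms cut_segments by (auto simp: between_def)
  define K'' where "K'' = (if K \<subseteq> K' then K' else K)"
  define L'' where "L'' = (if L \<subseteq> L' then L else L')"
  have "K \<subseteq> K''" "K' \<subseteq> K''" "L'' \<subseteq> L" "L'' \<subseteq> L'"
    using segments_total K assms by (auto simp: K''_def L''_def)
  moreover have "L'' \<in> segments" "K'' \<in> p" "L'' \<notin> p"
    using assms by (auto simp: K''_def L''_def between_def)
  ultimately show thesis
    using that[of L'' K''] p K cut_downward unfolding between_def by blast
qed

lemma topspace_cut_space: "topspace cut_space = cuts"
  unfolding cut_space_def interval_topology_def by auto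

text \<open>The set is the open ray above the cut \<open>a\<close> of segments strictly inside
  \<open>K\<close>. For \<open>K = {}\<close> that \<open>a\<close> would be empty, hence no cut,
  but then the set is the whole space.\<close>

lemma openin_above:
  assumes K: "K \<in> segments" shows "openin cut_space {p \<in> cuts. K \<in> p}"
proof (cases "K = {}")
  case True
  then have "{p \<in> cuts. K \<in> p} = topspace cut_space"
    using cut_bounds topspace_cut_space by auto
  then show ?thesis by simp
next
  case False
  define a where "a = {L \<in> segments. L \<subset> K}"
  have a: "a \<in> cuts" using K False empty_segment by (auto simp: cuts_def a_def segments_def)
  have "{p \<in> cuts. K \<in> p} = {p \<in> cuts. (a, p) \<in> cut_order \<and> p \<noteq> a}"
  proof (rule Collect_cong, rule conj_cong[OF refl], rule iffI)
    fix p assume p: "p \<in> cuts" and "K \<in> p"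
    then show "(a, p) \<in> cut_order \<and> p \<noteq> a"
      using a cut_downward[OF p] by (auto simp: cut_order_def a_def)
  next
    fix p assume p: "p \<in> cuts" and "(a, p) \<in> cut_order \<and> p \<noteq> a"
    then obtain L where L: "L \<in> p" "\<not> L \<subset> K"
      using cut_segments[OF p] by (auto simp: cut_order_def a_def)
    then show "K \<in> p"
      using segments_total[OF K] cut_segments[OF p] cut_downward[OF p _ K] by blast
  qed
  then show ?thesis
    unfolding cut_space_def interval_topology_def using a
    by (intro topology_generated_by_Basis) blast
qed

text \<open>The set is the open ray below the cut \<open>b\<close> of segments contained in
  \<open>K\<close>. For \<open>K = C\<close> that \<open>b\<close> would contain \<open>C\<close>,
  hence be no cut, but then the set is the whole space.\<close>

lemma openin_below:
  assumes K: "K \<in> segments" shows "openin cut_space {p \<in> cuts. K \<notin> p}"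
proof (cases "K = C")
  case True
  then have "{p \<in> cuts. K \<notin> p} = topspace cut_space"
    using cut_bounds topspace_cut_space by auto
  then show ?thesis by simp
next
  case False
  define b where "b = {L \<in> segments. L \<subseteq> K}"
  have b: "b \<in> cuts" using K False empty_segment by (auto simp: cuts_def b_def segments_def)
  have "{p \<in> cuts. K \<notin> p} = {p \<in> cuts. (p, b) \<in> cut_order \<and> p \<noteq> b}"
  proof (rule Collect_cong, rule conj_cong[OF refl], rule iffI)
    fix p assume p: "p \<in> cuts" and "K \<notin> p"
    then show "(p, b) \<in> cut_order \<and> p \<noteq> b"
      using b K subset_not_in_cut[OF p _ K] cut_segments[OF p] by (auto simp: cut_order_def b_def)
  next
    fix p assume p: "p \<in> cuts" and pb: "(p, b) \<in> cut_order \<and> p \<noteq> b"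
    show "K \<notin> p"
    proof
      assume "K \<in> p"
      then have "b \<subseteq> p" using cut_downward[OF p] by (auto simp: b_def)
      then show False using pb by (auto simp: cut_order_def)
    qed
  qed
  then show ?thesis
    unfolding cut_space_def interval_topology_def using b
    by (intro topology_generated_by_Basis) blast
qed

lemma openin_between:
  assumes "L \<in> segments" shows "openin cut_space (between K L)"
proof (cases "K \<in> segments")
  case True
  have "between K L = {p \<in> cuts. K \<in> p} \<inter> {p \<in> cuts. L \<notin> p}" by (auto simp: between_def)
  then show ?thesis using openin_Int[OF openin_above[OF True] openin_below[OF assms]] by simp
next
  case False
  then have "between K L = {}" using cut_segments by (auto simp: between_def)
  then show ?thesis by simp
qed

text \<open>Induction over the generation of the topology. Strict inequality of two cuts is
  witnessed by a segment in one but not in the other, which bounds the required basic set.\<close>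

lemma openin_cut_space_between:
  assumes "openin cut_space W" "p \<in> W"
  obtains K L where "L \<in> segments" "p \<in> between K L" "between K L \<subseteq> W"
proof -
  have "generate_topology_on (insert cuts
     ({{x \<in> cuts. (a, x) \<in> cut_order \<and> x \<noteq> a} | a. a \<in> cuts} \<union>
      {{x \<in> cuts. (x, b) \<in> cut_order \<and> x \<noteq> b} | b. b \<in> cuts})) W"
    using assms(1) unfolding cut_space_def interval_topology_def
    by (rule openin_topology_generated_by)
  then have "\<exists>K L. L \<in> segments \<and> p \<in> between K L \<and> between K L \<subseteq> W" using assms(2)
  proof induction
    case Empty
    then show ?case by simp
  next
    case (Int a b)
    then obtain K L K' L' where
      "L \<in> segments" "p \<in> between K L" "between K L \<subseteq> a"
      "L' \<in> segments" "p \<in> between K' L'" "between K' L' \<subseteq> b" by blast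
    moreover from this obtain K'' L'' where "L'' \<in> segments" "p \<in> between K'' L''"
      "between K'' L'' \<subseteq> between K L \<inter> between K' L'"
      using between_inter by metis
    ultimately show ?case by blast
  next
    case (UN \<K>)
    then show ?case by blast
  next
    case (Basis s)
    then have p: "p \<in> cuts" by auto
    consider "s = cuts" | a where "a \<in> cuts" "s = {x \<in> cuts. (a, x) \<in> cut_order \<and> x \<noteq> a}"
      | b where "b \<in> cuts" "s = {x \<in> cuts. (x, b) \<in> cut_order \<and> x \<noteq> b}"
      using Basis by blast
    then show ?case
    proof cases
      case 1
      \<comment> \<open>\<open>{}\<close> and \<open>C\<close> serve as vacuous lower and upper
        bounds, here and in the two ray cases.\<close>
      then show ?thesis using p carrier_segment cut_bounds
        by (intro exI[of _ "{}"] exI[of _ C]) (auto simp: between_def)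
    next
      case 2
      then obtain K where "K \<in> p" "K \<notin> a" using Basis.prems by (auto simp: cut_order_def)
      then show ?thesis using p 2 carrier_segment cut_bounds cuts_total
        by (intro exI[of _ K] exI[of _ C]) (auto simp: between_def cut_order_def)
    next
      case 3
      then obtain L where "L \<in> b" "L \<notin> p" using Basis.prems by (auto simp: cut_order_def)
      then have "L \<in> segments" using cut_segments 3 by blast
      then show ?thesis using p 3 \<open>L \<in> b\<close> \<open>L \<notin> p\<close> cut_bounds cuts_total
        by (intro exI[of _ "{}"] exI[of _ L]) (auto simp: between_def cut_order_def)
    qed
  qed
  then show thesis using that by blast
qed

section \<open>Compactness and the Hausdorff property\<close>

text \<open>As in the supremum proof for closed intervals, \<open>p\<close> collects the segments up
  to which finitely many members of the cover suffice. If \<open>C\<close> is not among them,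
  \<open>p\<close> is itself a cut, and a member of the cover around \<open>p\<close> extends a
  finite cover past \<open>p\<close>.\<close>

lemma compact_cut_space: "compact_space cut_space"
  unfolding compact_space_alt
proof (intro allI impI)
  fix \<U> assume \<U>: "(\<forall>U\<in>\<U>. openin cut_space U) \<and> topspace cut_space \<subseteq> \<Union>\<U>"
  define P where "P K \<longleftrightarrow> (\<exists>\<F>. finite \<F> \<and> \<F> \<subseteq> \<U> \<and> {q \<in> cuts. K \<notin> q} \<subseteq> \<Union>\<F>)" for K
  define p where "p = {K \<in> segments. P K}"
  have "P C"
  proof (rule ccontr)
    assume "\<not> P C"
    have "P {}" unfolding P_def using cut_bounds by (intro exI[of _ "{}"]) auto
    have "K \<in> p" if K: "K \<in> segments" and L: "L \<in> p" and "K \<subseteq> L" for K L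
    proof -
      have "{q \<in> cuts. K \<notin> q} \<subseteq> {q \<in> cuts. L \<notin> q}"
        using cut_downward[OF _ _ K \<open>K \<subseteq> L\<close>] by blast
      then show ?thesis using K L unfolding p_def P_def by blast
    qed
    moreover have "p \<subseteq> segments" "{} \<in> p" "C \<notin> p"
      using \<open>P {}\<close> \<open>\<not> P C\<close> empty_segment by (auto simp: p_def)
    ultimately have p: "p \<in> cuts" unfolding cuts_def by blast
    then obtain W where W: "W \<in> \<U>" "p \<in> W" using \<U> topspace_cut_space by blast
    then obtain K L where KL: "L \<in> segments" "p \<in> between K L" "between K L \<subseteq> W"
      using \<U> openin_cut_space_between by metis
    then have "K \<in> p" "L \<notin> p" by (auto simp: between_def)
    then obtain \<F> where \<F>: "finite \<F>" "\<F> \<subseteq> \<U>" "{q \<in> cuts. K \<notin> q} \<subseteq> \<Union>\<F>"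
      unfolding p_def P_def by blast
    \<comment> \<open>A cut omitting \<open>L\<close> either omits \<open>K\<close> as well or lies
      in \<open>between K L\<close>, hence in \<open>W\<close>.\<close>
    then have "{q \<in> cuts. L \<notin> q} \<subseteq> \<Union>(insert W \<F>)"
      using KL by (auto simp: between_def)
    then have "P L" unfolding P_def using \<F> W by (intro exI[of _ "insert W \<F>"]) auto
    then show False using \<open>L \<notin> p\<close> KL by (simp add: p_def)
  qed
  moreover have "{q \<in> cuts. C \<notin> q} = topspace cut_space"
    using cut_bounds topspace_cut_space by auto
  ultimately show "\<exists>\<F>. finite \<F> \<and> \<F> \<subseteq> \<U> \<and> topspace cut_space \<subseteq> \<Union>\<F>"
    unfolding P_def by simp
qed

text \<open>A segment in one cut but not in the other splits the space into two complementary open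
  sets.\<close>

lemma Hausdorff_cut_space: "Hausdorff_space cut_space"
proof -
  have separate: "\<exists>U V. openin cut_space U \<and> openin cut_space V \<and> p \<in> U \<and> q \<in> V \<and> disjnt U V"
    if p: "p \<in> cuts" and q: "q \<in> cuts" and "\<not> p \<subseteq> q" for p q
  proof -
    obtain K where K: "K \<in> p" "K \<notin> q" using \<open>\<not> p \<subseteq> q\<close> by blast
    then have "K \<in> segments" using p cut_segments by blast
    then show ?thesis
      using openin_above[of K] openin_below[of K] K p q
      by (intro exI[of _ "{r \<in> cuts. K \<in> r}"] exI[of _ "{r \<in> cuts. K \<notin> r}"])
        (auto simp: disjnt_def)
  qed
  show ?thesis
    unfolding Hausdorff_space_def topspace_cut_space
  proof (intro allI impI, elim conjE)
    fix p q assume "p \<in> cuts" "q \<in> cuts" "p \<noteq> q"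
    then show "\<exists>U V. openin cut_space U \<and> openin cut_space V \<and> p \<in> U \<and> q \<in> V \<and> disjnt U V"
      by (cases "p \<subseteq> q") (use separate disjnt_sym in \<open>meson subset_antisym\<close>)+
  qed
qed

section \<open>The dense discrete copy of the ordered set\<close>

text \<open>If \<open>between K L\<close> contains a cut, then \<open>K\<close> lies strictly inside
  \<open>L\<close>, and any \<open>g\<close> in the difference gives a \<open>point g\<close> in
  \<open>between K L\<close>.\<close>

lemma dense_points: "cut_space closure_of (point ` C) = topspace cut_space"
  unfolding dense_intersects_open
proof (intro allI impI, elim conjE)
  fix W assume "openin cut_space W" "W \<noteq> {}"
  then obtain p K L where *: "L \<in> segments" "p \<in> between K L" "between K L \<subseteq> W"
    using openin_cut_space_between by (metis ex_in_conv)
  then have p: "p \<in> cuts" "K \<in> p" "L \<notin> p" by (auto simp: between_def)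
  then obtain g where "g \<in> L" "g \<notin> K" using subset_not_in_cut * by blast
  moreover have "g \<in> C" using \<open>g \<in> L\<close> * by (auto simp: segments_def)
  ultimately have "point g \<in> between K L"
    using p cut_segments[of p K] point_cut by (auto simp: between_def point_def)
  then show "point ` C \<inter> W \<noteq> {}" using * \<open>g \<in> C\<close> by blast
qed

text \<open>The two segments differ only by \<open>g\<close>, so no segment lies strictly between
  them. A cut containing the first but not the second is thus determined, and \<open>point g\<close>
  is isolated.\<close>

lemma between_point:
  assumes "g \<in> C" shows "between (less_segment g) (le_segment g) = {point g}"
proof (intro equalityI subsetI)
  fix p assume "p \<in> between (less_segment g) (le_segment g)"
  then have p: "p \<in> cuts" "less_segment g \<in> p" "le_segment g \<notin> p" by (auto simp: between_def)
  have "K \<in> p \<longleftrightarrow> g \<notin> K" if "K \<in> segments" for K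
    using p that le_segment_subset[OF that] segment_subset_less_segment[OF that assms]
      cut_downward[of p K "le_segment g"] cut_downward[of p "less_segment g" K] le_segment
    by blast
  then show "p \<in> {point g}" using p cut_segments by (auto simp: point_def)
next
  fix p assume "p \<in> {point g}"
  then show "p \<in> between (less_segment g) (le_segment g)"
    using point_cut[OF assms] less_segment le_segment rel_refl[OF assms]
    by (simp add: between_def point_def) (auto simp: less_segment_def le_segment_def)
qed

lemma inj_point: "inj_on point C"
proof (rule inj_onI)
  fix g h assume gh: "g \<in> C" "h \<in> C" "point g = point h"
  have "less_segment g \<in> point g" "less_segment h \<in> point h"
    using less_segment by (auto simp: point_def less_segment_def)
  then have "h \<notin> less_segment g" "g \<notin> less_segment h" using gh by (auto simp: point_def)
  then show "g = h" using rel_total gh by (auto simp: less_segment_def)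
qed

lemma continuous_point: "continuous_map (discrete_topology C) cut_space point"
  using point_cut topspace_cut_space by (auto simp: continuous_map_def)

lemma embedding_point: "embedding_map (discrete_topology C) cut_space point"
proof (rule injective_open_imp_embedding_map)
  show "continuous_map (discrete_topology C) cut_space point" by (fact continuous_point)
  have "openin cut_space (point ` U)" if "U \<subseteq> C" for U
  proof -
    have "openin cut_space {point g}" if "g \<in> C" for g
      using openin_between[OF le_segment, of "less_segment g" g] between_point[OF that] by simp
    then have "openin cut_space (\<Union>g\<in>U. {point g})" using that by (intro openin_Union) blast
    moreover have "point ` U = (\<Union>g\<in>U. {point g})" by blast
    ultimately show ?thesis by simp
  qed
  then show "open_map (discrete_topology C) cut_space point"
    by (auto simp: open_map_def)
qed (use inj_point in simp)

text \<open>Continuity into the product topology is checked coordinatewise, each segment being a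
  two-valued coordinate.\<close>

lemma continuous_map_cut_space:
  assumes f: "f \<in> topspace Y \<rightarrow> cuts"
    and K: "\<And>K. K \<in> segments \<Longrightarrow> openin Y {y \<in> topspace Y. K \<in> f y}"
    and L: "\<And>L. L \<in> segments \<Longrightarrow> openin Y {y \<in> topspace Y. L \<notin> f y}"
  shows "continuous_map Y cut_space f"
  unfolding continuous_map_def topspace_cut_space
proof (intro conjI allI impI f)
  fix W assume W: "openin cut_space W"
  show "openin Y {y \<in> topspace Y. f y \<in> W}"
  proof (subst openin_subopen, intro ballI)
    fix y assume y: "y \<in> {y \<in> topspace Y. f y \<in> W}"
    obtain K' L' where *: "L' \<in> segments" "f y \<in> between K' L'" "between K' L' \<subseteq> W"
      using openin_cut_space_between[OF W] y by blast
    have "K' \<in> segments" using * cut_segments by (auto simp: between_def)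
    then have "openin Y ({y \<in> topspace Y. K' \<in> f y} \<inter> {y \<in> topspace Y. L' \<notin> f y})"
      using K L * by (intro openin_Int) auto
    moreover have "{y \<in> topspace Y. K' \<in> f y} \<inter> {y \<in> topspace Y. L' \<notin> f y} \<subseteq>
        {y \<in> topspace Y. f y \<in> W}"
      using * f by (auto simp: between_def)
    ultimately show "\<exists>T. openin Y T \<and> y \<in> T \<and> T \<subseteq> {y \<in> topspace Y. f y \<in> W}"
      using y * by (intro exI conjI) (auto simp: between_def)
  qed
qed

section \<open>First countability and hereditary separability\<close>

text \<open>
  A point \<open>p\<close> is isolated on one side: on the left if \<open>\<Union>p \<in> p\<close>, on the right otherwise. The two
  lemmas say that principal segments suffice to approximate \<open>p\<close> from the other side.
\<close>

lemma approximate_above: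
  assumes p: "p \<in> cuts" and "\<Union>p \<in> p" and L: "L \<in> segments" "L \<notin> p"
  obtains L' where "L' \<in> principal_segments" "L' \<subseteq> L" "L' \<notin> p"
proof -
  \<comment> \<open>Here \<open>\<Union>p\<close> is the greatest member of \<open>p\<close>, so
    \<open>L\<close> reaches strictly beyond it. A segment containing such a \<open>g\<close> cannot
    belong to \<open>p\<close>.\<close>
  obtain g where g: "g \<in> L" "g \<notin> \<Union>p"
    using subset_not_in_cut[OF p assms(2) L] by blast
  then have "g \<in> C" using L by (auto simp: segments_def)
  then have "g \<in> le_segment g" using rel_refl by (simp add: le_segment_def)
  then show thesis
    using that[of "le_segment g"] le_segment_subset[OF L(1) g(1)] g \<open>g \<in> C\<close>
    by (auto simp: principal_segments_def)
qed

lemma approximate_below: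
  assumes p: "p \<in> cuts" and "\<Union>p \<notin> p" and K: "K \<in> p"
  obtains K' where "K' \<in> principal_segments" "K \<subseteq> K'" "K' \<in> p"
proof -
  \<comment> \<open>Without a greatest member, \<open>p\<close> has a member reaching beyond
    \<open>K\<close>.\<close>
  have "\<not> \<Union>p \<subseteq> K" using assms Union_upper[OF K] by (metis subset_antisym)
  then obtain g L where g: "g \<in> L" "L \<in> p" "g \<notin> K" by blast
  then have "L \<in> segments" "K \<in> segments" using p K cut_segments by auto
  then have "g \<in> C" using g by (auto simp: segments_def)
  show thesis
    using that[of "less_segment g"] less_segment_subset[OF \<open>L \<in> segments\<close> g(1)] \<open>g \<in> C\<close>
      segment_subset_less_segment[OF \<open>K \<in> segments\<close> \<open>g \<in> C\<close> g(3)]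
      cut_downward[OF p g(2) less_segment] by (simp add: principal_segments_def)
qed

text \<open>Principal segments bound \<open>p\<close> on one side and \<open>\<Union>p\<close> on
  the other: it is the greatest member of \<open>p\<close> if it belongs to \<open>p\<close>, and
  the least segment outside \<open>p\<close> otherwise.\<close>

lemma first_countable_cut_space:
  assumes "countable C" shows "first_countable cut_space"
  unfolding first_countable_def topspace_cut_space
proof
  fix p assume p: "p \<in> cuts"
  define \<A> where "\<A> = insert (\<Union>p) principal_segments"
  define \<B> where "\<B> = (\<lambda>(K, L). between K L) ` {(K, L). K \<in> \<A> \<and> L \<in> \<A> \<inter> segments}"
  have "countable \<A>" using assms by (simp add: \<A>_def principal_segments_def)
  then have "countable (\<A> \<times> \<A>)" by simp
  then have "countable {(K, L). K \<in> \<A> \<and> L \<in> \<A> \<inter> segments}"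
    by (rule countable_subset[rotated]) blast
  then have count: "countable \<B>" unfolding \<B>_def by (rule countable_image)
  have opens: "\<forall>V\<in>\<B>. openin cut_space V" using openin_between by (auto simp: \<B>_def)
  have base: "\<exists>V\<in>\<B>. p \<in> V \<and> V \<subseteq> U" if U: "openin cut_space U" "p \<in> U" for U
  proof -
    obtain K L where *: "L \<in> segments" "p \<in> between K L" "between K L \<subseteq> U"
      using openin_cut_space_between[OF U] .
    then have KL: "K \<in> p" "L \<notin> p" "K \<in> segments" using cut_segments[OF p] by (auto simp: between_def)
    have "p \<subseteq> segments" using cut_segments[OF p] by blast
    then have "\<Union>p \<in> segments" by (intro Union_segment)
    have \<A>: "\<Union>p \<in> \<A>" "principal_segments \<subseteq> \<A>" by (auto simp: \<A>_def)
    have "\<exists>K'\<in>\<A>. K \<subseteq> K' \<and> K' \<in> p"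
    proof (cases "\<Union>p \<in> p")
      case True
      show ?thesis by (intro bexI[OF _ \<A>(1)] conjI Union_upper KL(1) True)
    next
      case False
      obtain K' where "K' \<in> principal_segments" "K \<subseteq> K'" "K' \<in> p"
        using approximate_below[OF p False KL(1)] .
      then show ?thesis using \<A>(2) by (metis subsetD)
    qed
    then obtain K' where K': "K' \<in> \<A>" "K \<subseteq> K'" "K' \<in> p" by metis
    have "\<exists>L'\<in>\<A> \<inter> segments. L' \<subseteq> L \<and> L' \<notin> p"
    proof (cases "\<Union>p \<in> p")
      case True
      obtain L' where "L' \<in> principal_segments" "L' \<subseteq> L" "L' \<notin> p"
        using approximate_above[OF p True *(1) KL(2)] .
      then show ?thesis using \<A>(2) principal_segments_subset by (metis IntI subsetD)
    next
      case False
      have "\<Union>p \<subseteq> L" using subset_not_in_cut[OF p _ *(1) KL(2)] by (intro Union_least) auto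
      then show ?thesis
        using False \<open>\<Union>p \<in> segments\<close> \<A>(1) by (metis IntI)
    qed
    then obtain L' where L': "L' \<in> \<A>" "L' \<in> segments" "L' \<subseteq> L" "L' \<notin> p" by (metis IntE)
    have "q \<in> between K L" if "q \<in> between K' L'" for q
      using that K' L' cut_downward[of q K' K] cut_downward[of q L L'] KL(3)
      by (auto simp: between_def)
    moreover have "between K' L' \<in> \<B>" using K' L' by (auto simp: \<B>_def)
    moreover have "p \<in> between K' L'" using p K' L' by (simp add: between_def)
    ultimately show ?thesis using *(3) by (intro bexI[of _ "between K' L'"]) auto
  qed
  show "\<exists>\<B>. countable \<B> \<and> (\<forall>V\<in>\<B>. openin cut_space V) \<and>
      (\<forall>U. openin cut_space U \<and> p \<in> U \<longrightarrow> (\<exists>V\<in>\<B>. p \<in> V \<and> V \<subseteq> U))" by (intro exI[of _ \<B>] conjI allI impI count opens base) simp_all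
qed

text \<open>\<open>E1\<close> samples \<open>Y\<close> in each basic set with principal bounds. It
  can miss points of \<open>Y\<close> that are isolated in \<open>Y\<close> from one side; these are
  least in \<open>Y\<close> among cuts containing a principal segment (\<open>E2\<close>) or
  greatest among cuts omitting one (\<open>E3\<close>).\<close>

lemma countable_dense_in_cut_space:
  assumes "countable C" and Y: "Y \<subseteq> cuts"
  obtains E where "countable E" "E \<subseteq> Y"
    "\<And>p K L. L \<in> segments \<Longrightarrow> p \<in> Y \<Longrightarrow> p \<in> between K L \<Longrightarrow> E \<inter> between K L \<noteq> {}"
proof -
  let ?P = principal_segments
  have P: "countable ?P" using assms(1) by (simp add: principal_segments_def)
  define E0 where "E0 A B = (SOME d. d \<in> Y \<inter> between A B)" for A B
  define E1 where "E1 = (\<lambda>(A, B). E0 A B) ` {(A, B) \<in> ?P \<times> ?P. Y \<inter> between A B \<noteq> {}}"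
  \<comment> \<open>Intersecting with \<open>Y\<close> discards unspecified values of
    \<open>THE\<close> outside \<open>Y\<close>, which may arise when no least element
    exists.\<close>
  define E2 where
    "E2 = (\<lambda>A. THE d. d \<in> Y \<and> A \<in> d \<and> (\<forall>z\<in>Y. A \<in> z \<longrightarrow> d \<subseteq> z)) ` ?P \<inter> Y"
  define E3 where
    "E3 = (\<lambda>B. THE d. d \<in> Y \<and> B \<notin> d \<and> (\<forall>z\<in>Y. B \<notin> z \<longrightarrow> z \<subseteq> d)) ` ?P \<inter> Y"
  have "countable {(A, B) \<in> ?P \<times> ?P. Y \<inter> between A B \<noteq> {}}"
    using P by (intro countable_subset[OF _ countable_SIGMA[of ?P "\<lambda>_. ?P"]]) auto
  then have count: "countable (E1 \<union> E2 \<union> E3)"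
    using P by (auto simp: E1_def E2_def E3_def)
  have E0: "E0 A B \<in> Y \<inter> between A B" if "Y \<inter> between A B \<noteq> {}" for A B
    unfolding E0_def by (rule someI_ex) (use that in blast)
  then have "E1 \<subseteq> Y" by (auto simp: E1_def)
  have E1: "E1 \<inter> between A B \<noteq> {}" if "A \<in> ?P" "B \<in> ?P" "Y \<inter> between A B \<noteq> {}" for A B
  proof -
    have "E0 A B \<in> E1"
      unfolding E1_def by (rule image_eqI[of _ _ "(A, B)"]) (use that in simp_all)
    then show ?thesis using E0[OF that(3)] by (metis IntD2 IntI emptyE)
  qed
  have E2: "d \<in> E2" if "A \<in> ?P" "d \<in> Y" "A \<in> d" "\<forall>z\<in>Y. A \<in> z \<longrightarrow> d \<subseteq> z" for A d
  proof -
    have "(THE d. d \<in> Y \<and> A \<in> d \<and> (\<forall>z\<in>Y. A \<in> z \<longrightarrow> d \<subseteq> z)) = d"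
      using that by (intro the_equality) auto
    then show ?thesis using that unfolding E2_def by blast
  qed
  have E3: "d \<in> E3" if "B \<in> ?P" "d \<in> Y" "B \<notin> d" "\<forall>z\<in>Y. B \<notin> z \<longrightarrow> z \<subseteq> d" for B d
  proof -
    have "(THE d. d \<in> Y \<and> B \<notin> d \<and> (\<forall>z\<in>Y. B \<notin> z \<longrightarrow> z \<subseteq> d)) = d"
      using that by (intro the_equality) auto
    then show ?thesis using that unfolding E3_def by blast
  qed
  have dense: "(E1 \<union> E2 \<union> E3) \<inter> between K L \<noteq> {}"
    if L: "L \<in> segments" and "p \<in> Y" and pKL: "p \<in> between K L" for p K L
  proof -
    have p: "p \<in> cuts" using Y \<open>p \<in> Y\<close> by blast
    have KL: "K \<in> p" "L \<notin> p" "K \<in> segments"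
      using pKL cut_segments[OF p] by (auto simp: between_def)
    show ?thesis
    proof (cases "\<Union>p \<in> p")
      case True
      obtain B where B: "B \<in> ?P" "B \<subseteq> L" "B \<notin> p" using approximate_above[OF p True L KL(2)] .
      show ?thesis
      proof (cases "\<forall>z\<in>Y. B \<notin> z \<longrightarrow> z \<subseteq> p")
        case True
        then have "p \<in> E3" using E3 B \<open>p \<in> Y\<close> by blast
        then show ?thesis using pKL by blast
      next
        case False
        \<comment> \<open>Such a \<open>z\<close> lies above \<open>p\<close> and still omits
          \<open>B\<close>, which leaves room for a principal \<open>A\<close> outside
          \<open>p\<close> with \<open>z\<close> in \<open>between A B\<close>.\<close>
        then obtain z M where z: "z \<in> Y" "B \<notin> z" "M \<in> z" "M \<notin> p" by blast
        then have "z \<in> cuts" using Y by blast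
        then have "M \<in> segments" using z cut_segments by blast
        obtain A where A: "A \<in> ?P" "A \<subseteq> M" "A \<notin> p"
          using approximate_above[OF p \<open>\<Union>p \<in> p\<close> \<open>M \<in> segments\<close> z(4)] .
        have "A \<in> segments" "B \<in> segments" using A B principal_segments_subset by auto
        then have "A \<in> z" using cut_downward[OF \<open>z \<in> cuts\<close> z(3)] A by blast
        then have "z \<in> between A B" using z \<open>z \<in> cuts\<close> by (simp add: between_def)
        then obtain d where d: "d \<in> E1" "d \<in> between A B" using E1 A B z by blast
        have "K \<subseteq> A" using subset_not_in_cut[OF p KL(1) \<open>A \<in> segments\<close> A(3)] by blast
        then have "d \<in> between K L"
          using d cut_downward KL \<open>B \<in> segments\<close> B unfolding between_def by blast
        then show ?thesis using d by blast
      qed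
    next
      case False
      obtain A where A: "A \<in> ?P" "K \<subseteq> A" "A \<in> p" using approximate_below[OF p False KL(1)] .
      show ?thesis
      proof (cases "\<forall>z\<in>Y. A \<in> z \<longrightarrow> p \<subseteq> z")
        case True
        then have "p \<in> E2" using E2 A \<open>p \<in> Y\<close> by blast
        then show ?thesis using pKL by blast
      next
        case False
        \<comment> \<open>The mirror image: \<open>z\<close> lies below \<open>p\<close> and still
          contains \<open>A\<close>, so a principal \<open>B\<close> in \<open>p\<close> bounds it
          above.\<close>
        then obtain z M where z: "z \<in> Y" "A \<in> z" "M \<in> p" "M \<notin> z" by blast
        then have "z \<in> cuts" using Y by blast
        obtain B where B: "B \<in> ?P" "M \<subseteq> B" "B \<in> p"
          using approximate_below[OF p \<open>\<Union>p \<notin> p\<close> z(3)] .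
        have "M \<in> segments" "B \<in> segments" using z B p cut_segments by auto
        then have "B \<notin> z" using cut_downward[OF \<open>z \<in> cuts\<close>] z B by blast
        then have "z \<in> between A B" using z \<open>z \<in> cuts\<close> by (simp add: between_def)
        then obtain d where d: "d \<in> E1" "d \<in> between A B" using E1 A B z by blast
        have "B \<subseteq> L" using subset_not_in_cut[OF p B(3) L KL(2)] by blast
        then have "d \<in> between K L"
          using d cut_downward KL \<open>B \<in> segments\<close> A unfolding between_def by blast
        then show ?thesis using d by blast
      qed
    qed
  qed
  have subset: "E1 \<union> E2 \<union> E3 \<subseteq> Y" using \<open>E1 \<subseteq> Y\<close> by (auto simp: E2_def E3_def)
  show thesis by (rule that[OF count subset dense])
qed

lemma hereditarily_separable_cut_space:
  assumes "countable C" shows "hereditarily_separable cut_space"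
  unfolding hereditarily_separable_def topspace_cut_space separable_space_def
proof (intro allI impI)
  fix Y assume Y: "Y \<subseteq> cuts"
  obtain E where E: "countable E" "E \<subseteq> Y"
    "\<And>p K L. L \<in> segments \<Longrightarrow> p \<in> Y \<Longrightarrow> p \<in> between K L \<Longrightarrow> E \<inter> between K L \<noteq> {}"
    by (rule countable_dense_in_cut_space[OF assms Y]) blast
  have "(subtopology cut_space Y) closure_of E = topspace (subtopology cut_space Y)"
    unfolding dense_intersects_open
  proof (intro allI impI, elim conjE)
    fix T assume T: "openin (subtopology cut_space Y) T" "T \<noteq> {}"
    then obtain W p where W: "openin cut_space W" "T = W \<inter> Y" "p \<in> W" "p \<in> Y"
      by (auto simp: openin_subtopology)
    obtain K L where KL: "L \<in> segments" "p \<in> between K L" "between K L \<subseteq> W"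
      using openin_cut_space_between[OF W(1,3)] .
    show "E \<inter> T \<noteq> {}" using E(2) E(3)[OF KL(1) W(4) KL(2)] KL(3) W(2) by auto
  qed
  then show "\<exists>E. countable E \<and> E \<subseteq> topspace (subtopology cut_space Y) \<and>
      (subtopology cut_space Y) closure_of E = topspace (subtopology cut_space Y)"
    using E(1,2) Y topspace_cut_space by (intro exI[of _ E]) (simp add: Int_absorb1)
qed

end

section \<open>Multiplication of cuts over a bi-ordered group\<close>

locale bi_ordered_group = group G for G :: "('a, 'm) monoid_scheme" (structure) +
  fixes R :: "'a rel"
  assumes bi_invariant: "bi_invariant_linear_order G R"
begin

sublocale linearly_ordered_set "carrier G" R
  using bi_invariant by unfold_locales (simp add: bi_invariant_linear_order_def)

lemma rel_mult_left:
  "g \<in> carrier G \<Longrightarrow> (x, y) \<in> R \<Longrightarrow> (g \<otimes> x, g \<otimes> y) \<in> R"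
  using bi_invariant rel_carrier unfolding bi_invariant_linear_order_def by blast

lemma rel_mult_right:
  "g \<in> carrier G \<Longrightarrow> (x, y) \<in> R \<Longrightarrow> (x \<otimes> g, y \<otimes> g) \<in> R"
  using bi_invariant rel_carrier unfolding bi_invariant_linear_order_def by blast

text \<open>This is the translate of \<open>K\<close> by \<open>inv a\<close>.\<close>

definition translate :: "'a \<Rightarrow> 'a set \<Rightarrow> 'a set" where
  "translate a K = {b \<in> carrier G. a \<otimes> b \<in> K}"

text \<open>For a segment \<open>K\<close> and a cut \<open>q\<close> these are the \<open>a\<close>
  for which \<open>mult_cut (point a) q\<close> omits \<open>K\<close>, as
  \<open>mem_mult_cut_point\<close> shows.\<close>

definition pull :: "'a set \<Rightarrow> 'a set set \<Rightarrow> 'a set" where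
  "pull K q = {a \<in> carrier G. translate a K \<notin> q}"

definition mult_cut :: "'a set set \<Rightarrow> 'a set set \<Rightarrow> 'a set set" where
  "mult_cut p q = {K \<in> segments. pull K q \<in> p}"

lemma translate_segment: "a \<in> carrier G \<Longrightarrow> K \<in> segments \<Longrightarrow> translate a K \<in> segments"
  unfolding segments_def translate_def using rel_mult_left rel_carrier by blast

lemma translate_translate:
  "a \<in> carrier G \<Longrightarrow> b \<in> carrier G \<Longrightarrow> translate b (translate a K) = translate (a \<otimes> b) K"
  unfolding translate_def by (auto simp: m_assoc)

text \<open>Right invariance enters here: as \<open>a\<close> grows, \<open>translate a K\<close>
  shrinks, so failure to lie in \<open>q\<close> passes down to smaller \<open>a\<close>. Left
  invariance is what makes \<open>translate a K\<close> a segment.\<close>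

lemma pull_segment:
  assumes K: "K \<in> segments" and q: "q \<in> cuts"
  shows "pull K q \<in> segments"
proof -
  have "x \<in> pull K q" if xy: "(x, y) \<in> R" and y: "y \<in> pull K q" for x y
  proof -
    have "translate y K \<subseteq> translate x K"
      using K rel_mult_right[OF _ xy] by (auto simp: translate_def segments_def)
    then show ?thesis
      using y rel_carrier[OF xy] cut_downward[OF q] translate_segment[OF _ K] by (auto simp: pull_def)
  qed
  then show ?thesis unfolding segments_def by (auto simp: pull_def)
qed

lemma pull_mono:
  assumes "q \<in> cuts" "K \<in> segments" "K \<subseteq> L" shows "pull K q \<subseteq> pull L q"
  using cut_downward[OF assms(1)] translate_segment assms(2,3)
  unfolding pull_def translate_def by blast

text \<open>With \<open>pull_carrier\<close>, this transfers the two end conditions on cuts to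
  products.\<close>

lemma pull_empty: "q \<in> cuts \<Longrightarrow> pull {} q = {}"
  using cut_bounds by (auto simp: pull_def translate_def)

lemma pull_carrier: "q \<in> cuts \<Longrightarrow> pull (carrier G) q = carrier G"
proof -
  assume "q \<in> cuts"
  moreover have "translate a (carrier G) = carrier G" if "a \<in> carrier G" for a
    using that by (auto simp: translate_def)
  ultimately show ?thesis using cut_bounds by (auto simp: pull_def)
qed

lemma mult_cut_closed:
  assumes p: "p \<in> cuts" and q: "q \<in> cuts"
  shows "mult_cut p q \<in> cuts"
proof -
  have "pull K q \<in> p" if "K \<in> segments" "pull L q \<in> p" "K \<subseteq> L" for K L
    using cut_downward[OF p that(2) pull_segment[OF that(1) q]] pull_mono[OF q] that by blast
  then have "K \<in> mult_cut p q" if "K \<in> segments" "L \<in> mult_cut p q" "K \<subseteq> L" for K L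
    using that unfolding mult_cut_def by blast
  moreover have "{} \<in> mult_cut p q" "carrier G \<notin> mult_cut p q" "mult_cut p q \<subseteq> segments"
    using cut_bounds[OF p] pull_empty[OF q] pull_carrier[OF q] empty_segment
    by (auto simp: mult_cut_def)
  ultimately show ?thesis unfolding cuts_def by blast
qed

text \<open>The core of associativity: \<open>translate a\<close> commutes with \<open>pull\<close>,
  because translating by \<open>a\<close> and then by \<open>b\<close> is translating by
  \<open>a \<otimes> b\<close>.\<close>

lemma pull_mult_cut:
  assumes "K \<in> segments"
  shows "pull K (mult_cut q s) = pull (pull K s) q"
proof -
  have "translate a (pull K s) = pull (translate a K) s" if "a \<in> carrier G" for a
  proof -
    have "translate a (pull K s) = {b \<in> carrier G. translate (a \<otimes> b) K \<notin> s}"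
      unfolding translate_def[of a "pull K s"] using that by (auto simp: pull_def)
    also have "\<dots> = pull (translate a K) s"
      using that translate_translate by (auto simp: pull_def)
    finally show ?thesis .
  qed
  then show ?thesis
    using translate_segment[OF _ assms] unfolding pull_def[of _ q] pull_def[of _ "mult_cut q s"]
    by (auto simp: mult_cut_def)
qed

lemma mult_cut_assoc:
  assumes "s \<in> cuts"
  shows "mult_cut (mult_cut p q) s = mult_cut p (mult_cut q s)"
  using pull_segment[OF _ assms] pull_mult_cut by (auto simp: mult_cut_def)

lemma mult_cut_mono_left: "p \<subseteq> p' \<Longrightarrow> mult_cut p q \<subseteq> mult_cut p' q"
  by (auto simp: mult_cut_def)

text \<open>Enlarging \<open>q\<close> shrinks \<open>pull K q\<close>, and \<open>p\<close> is
  closed downward.\<close>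

lemma mult_cut_mono_right:
  assumes "p \<in> cuts" "q \<in> cuts" "q' \<in> cuts" "q \<subseteq> q'"
  shows "mult_cut p q \<subseteq> mult_cut p q'"
proof -
  have "pull K q' \<subseteq> pull K q" for K using assms(4) by (auto simp: pull_def)
  then show ?thesis
    using cut_downward[OF assms(1)] pull_segment assms(3) by (auto simp: mult_cut_def)
qed

text \<open>Multiplying by a group element on the left merely permutes coordinates, which yields
  both multiplicativity of \<open>point\<close> and continuity of the action.\<close>

lemma mem_mult_cut_point:
  assumes "g \<in> carrier G" "q \<in> cuts" "K \<in> segments"
  shows "K \<in> mult_cut (point g) q \<longleftrightarrow> translate g K \<in> q"
  using assms pull_segment by (auto simp: mult_cut_def point_def pull_def)

lemma mult_cut_points:
  assumes g: "g \<in> carrier G" and h: "h \<in> carrier G"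
  shows "mult_cut (point g) (point h) = point (g \<otimes> h)"
proof (rule Set.set_eqI)
  fix K
  show "K \<in> mult_cut (point g) (point h) \<longleftrightarrow> K \<in> point (g \<otimes> h)"
  proof (cases "K \<in> segments")
    case True
    then show ?thesis
      using mem_mult_cut_point[OF g point_cut[OF h] True] translate_segment[OF g True] h
      by (simp add: point_def translate_def)
  qed (simp add: mult_cut_def point_def)
qed

section \<open>Continuity of right translations and of the group action\<close>

text \<open>Coordinate \<open>K\<close> of the product with \<open>s\<close> is coordinate
  \<open>pull K s\<close> of \<open>p\<close>.\<close>

lemma continuous_mult_cut_left:
  assumes "s \<in> cuts"
  shows "continuous_map cut_space cut_space (\<lambda>p. mult_cut p s)"
proof (rule continuous_map_cut_space)
  show "(\<lambda>p. mult_cut p s) \<in> topspace cut_space \<rightarrow> cuts"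
    using mult_cut_closed[OF _ assms] by (simp add: topspace_cut_space)
next
  fix K assume K: "K \<in> segments"
  then show "openin cut_space {p \<in> topspace cut_space. K \<in> mult_cut p s}"
    "openin cut_space {p \<in> topspace cut_space. K \<notin> mult_cut p s}"
    using openin_above[OF pull_segment[OF K assms]] openin_below[OF pull_segment[OF K assms]]
    by (simp_all add: topspace_cut_space mult_cut_def)
qed

lemma continuous_point_mult_cut:
  assumes "g \<in> carrier G"
  shows "continuous_map cut_space cut_space (mult_cut (point g))"
proof (rule continuous_map_cut_space)
  show "mult_cut (point g) \<in> topspace cut_space \<rightarrow> cuts"
    using mult_cut_closed[OF point_cut[OF assms]] by (simp add: topspace_cut_space)
next
  fix K assume K: "K \<in> segments"
  then have "{q \<in> cuts. K \<in> mult_cut (point g) q} = {q \<in> cuts. translate g K \<in> q}"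
    "{q \<in> cuts. K \<notin> mult_cut (point g) q} = {q \<in> cuts. translate g K \<notin> q}"
    using mem_mult_cut_point[OF assms] by auto
  then show "openin cut_space {q \<in> topspace cut_space. K \<in> mult_cut (point g) q}"
    "openin cut_space {q \<in> topspace cut_space. K \<notin> mult_cut (point g) q}"
    using openin_above openin_below translate_segment[OF assms K] by (auto simp: topspace_cut_space)
qed

text \<open>Since the group is discrete, the product is a disjoint union of open slices, so
  continuity in \<open>s\<close> for each fixed \<open>g\<close> suffices.\<close>

lemma continuous_discrete_action:
  "continuous_map (prod_topology (discrete_topology (carrier G)) cut_space) cut_space
     (\<lambda>(g, s). mult_cut (point g) s)"
  unfolding continuous_map_def
proof (intro conjI allI impI)
  show "(\<lambda>(g, s). mult_cut (point g) s)
      \<in> topspace (prod_topology (discrete_topology (carrier G)) cut_space) \<rightarrow> topspace cut_space"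
    using mult_cut_closed point_cut by (auto simp: topspace_cut_space)
next
  fix U assume U: "openin cut_space U"
  define V where "V g = {s \<in> topspace cut_space. mult_cut (point g) s \<in> U}" for g
  have "openin (prod_topology (discrete_topology (carrier G)) cut_space) ({g} \<times> V g)"
    if "g \<in> carrier G" for g
    using openin_continuous_map_preimage[OF continuous_point_mult_cut[OF that] U] that
    by (simp add: openin_prod_Times_iff V_def)
  then have "openin (prod_topology (discrete_topology (carrier G)) cut_space)
      (\<Union>g\<in>carrier G. {g} \<times> V g)"
    by (intro openin_Union) blast
  moreover have "(\<Union>g\<in>carrier G. {g} \<times> V g) =
      {x \<in> topspace (prod_topology (discrete_topology (carrier G)) cut_space).
        (case x of (g, s) \<Rightarrow> mult_cut (point g) s) \<in> U}"
    by (auto simp: V_def)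
  ultimately show "openin (prod_topology (discrete_topology (carrier G)) cut_space)
      {x \<in> topspace (prod_topology (discrete_topology (carrier G)) cut_space).
        (case x of (g, s) \<Rightarrow> mult_cut (point g) s) \<in> U}"
    by simp
qed

lemma topological_group_discrete: "topological_group G (discrete_topology (carrier G))"
  unfolding topological_group_def
  by (auto simp: is_group prod_topology_discrete_topology[symmetric])

lemma ordered_semigroup_compactification_cuts:
  "ordered_semigroup_compactification G (discrete_topology (carrier G)) R
     cut_space mult_cut cut_order point"
proof -
  have semigroup: "compact_right_topological_semigroup cut_space mult_cut"
    unfolding compact_right_topological_semigroup_def topspace_cut_space
    using mult_cut_closed mult_cut_assoc compact_cut_space Hausdorff_cut_space
      continuous_mult_cut_left by blast
  moreover have "linearly_ordered_compact_right_topological_semigroup cut_space mult_cut cut_order"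
    unfolding linearly_ordered_compact_right_topological_semigroup_def topspace_cut_space
  proof (intro conjI ballI impI)
    show "cut_space = interval_topology cuts cut_order" by (fact cut_space_def)
  next
    fix s p q assume "s \<in> cuts" "p \<in> cuts" "q \<in> cuts" "(p, q) \<in> cut_order"
    then show "(mult_cut s p, mult_cut s q) \<in> cut_order" "(mult_cut p s, mult_cut q s) \<in> cut_order"
      using mult_cut_closed mult_cut_mono_left mult_cut_mono_right by (simp_all add: cut_order_def)
  qed (use semigroup linear_order_cuts in auto)
  moreover have "right_topological_semigroup_compactification G (discrete_topology (carrier G))
      cut_space mult_cut point"
    unfolding right_topological_semigroup_compactification_def
    using topological_group_discrete semigroup continuous_point mult_cut_points dense_points
      continuous_discrete_action by blast
  moreover have "\<forall>x\<in>carrier G. \<forall>y\<in>carrier G. (x, y) \<in> R \<longrightarrow> (point x, point y) \<in> cut_order"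
    using point_cut point_mono by (auto simp: cut_order_def)
  ultimately show ?thesis
    using bi_invariant unfolding ordered_semigroup_compactification_def by blast
qed

end

section \<open>Orderability and dynamical orderability of discrete groups\<close>

theorem theorem5p8:
  fixes G :: "('a, 'm) monoid_scheme"
  assumes "group G"
  shows "(orderable_group G \<longleftrightarrow>
            dynamically_orderable TYPE('a set set) G (discrete_topology (carrier G))) \<and>
         (dynamically_orderable TYPE('s) G (discrete_topology (carrier G)) \<longrightarrow>
            orderable_group G) \<and>
         (countable (carrier G) \<and> orderable_group G \<longrightarrow>
            (\<exists>R (X :: 'a set set topology) m r \<gamma>.
               ordered_semigroup_compactification G (discrete_topology (carrier G)) R X m r \<gamma> \<and>
               embedding_map (discrete_topology (carrier G)) X \<gamma> \<and>
               first_countable X \<and> hereditarily_separable X))"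
proof (intro conjI impI iffI)
  assume "orderable_group G"
  then obtain R where "bi_invariant_linear_order G R" unfolding orderable_group_def by blast
  then interpret bi_ordered_group G R
    using assms by (simp add: bi_ordered_group_def bi_ordered_group_axioms_def)
  show "dynamically_orderable TYPE('a set set) G (discrete_topology (carrier G))"
    unfolding dynamically_orderable_def
    using ordered_semigroup_compactification_cuts embedding_point by blast
next
  assume *: "countable (carrier G) \<and> orderable_group G"
  then obtain R where "bi_invariant_linear_order G R" unfolding orderable_group_def by blast
  then interpret bi_ordered_group G R
    using assms by (simp add: bi_ordered_group_def bi_ordered_group_axioms_def)
  show "\<exists>R (X :: 'a set set topology) m r \<gamma>.
      ordered_semigroup_compactification G (discrete_topology (carrier G)) R X m r \<gamma> \<and>
      embedding_map (discrete_topology (carrier G)) X \<gamma> \<and>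
      first_countable X \<and> hereditarily_separable X"
    using ordered_semigroup_compactification_cuts embedding_point
      first_countable_cut_space hereditarily_separable_cut_space * by blast
\<comment> \<open>For the converse directions, a bi-invariant order on \<open>G\<close> is part of
  the data of an ordered compactification, whatever type carries the semigroup.\<close>
qed (auto simp: dynamically_orderable_def ordered_semigroup_compactification_def
      orderable_group_def)

end
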